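(* For every odd integer $n\ge 9$ there exists an $n$-dimensional completable nilpotent complex Lie algebra which is not of maximal rank.
   Context: All Lie algebras are over $\mathbb{C}$. A torus over a nilpotent Lie algebra $\mathfrak{g}$ is an abelian subalgebra of $Der(\mathfrak{g})$ consisting of semisimple derivations. All tori maximal for inclusion have the same dimension, called $rank(\mathfrak{g})$. The algebra $\mathfrak{g}$ is of maximal rank if $rank(\mathfrak{g})=\dim H^1(\mathfrak{g},\mathbb{C})=\dim(\mathfrak{g}/[\mathfrak{g},\mathfrak{g}])$. A Lie algebra is complete if its center is zero and all its derivations are inner. A nilpotent Lie algebra $\mathfrak{g}$ is completable if the semidirect product $\mathfrak{t}\oplus\mathfrak{g}$ (with $\mathfrak{t}$ abelian and $[f,x]=f(x)$ for $f\in\mathfrak{t}$, $x\in\mathfrak{g}$) is complete for a maximal torus $\mathfrak{t}$ over $\mathfrak{g}$. *)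

theory Defs
  imports "HOL-Analysis.Analysis" "HOL-Library.Function_Algebras"
begin

text \<open>
  A complex Lie algebra lives on a subspace \<open>lie_carrier L\<close> of an ambient complex vector space,
  given by the scalar multiplication \<open>lie_scale L\<close> on a type of class \<^class>\<open>ab_group_add\<close>.
  The values of the bracket outside the carrier are irrelevant.
\<close>

record 'a lie_alg =
  lie_carrier :: "'a set"
  lie_scale :: "complex \<Rightarrow> 'a \<Rightarrow> 'a"
  lie_bracket :: "'a \<Rightarrow> 'a \<Rightarrow> 'a"

definition lie_algebra :: "('a::ab_group_add) lie_alg \<Rightarrow> bool" where
  "lie_algebra L \<longleftrightarrow>
     vector_space (lie_scale L) \<and>
     module.subspace (lie_scale L) (lie_carrier L) \<and>
     (\<forall>x\<in>lie_carrier L. \<forall>y\<in>lie_carrier L. lie_bracket L x y \<in> lie_carrier L) \<and>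
     (\<forall>x\<in>lie_carrier L. \<forall>y\<in>lie_carrier L. \<forall>z\<in>lie_carrier L.
        lie_bracket L (x + y) z = lie_bracket L x z + lie_bracket L y z \<and>
        lie_bracket L x (y + z) = lie_bracket L x y + lie_bracket L x z) \<and>
     (\<forall>c. \<forall>x\<in>lie_carrier L. \<forall>y\<in>lie_carrier L.
        lie_bracket L (lie_scale L c x) y = lie_scale L c (lie_bracket L x y) \<and>
        lie_bracket L x (lie_scale L c y) = lie_scale L c (lie_bracket L x y)) \<and>
     (\<forall>x\<in>lie_carrier L. lie_bracket L x x = 0) \<and>
     (\<forall>x\<in>lie_carrier L. \<forall>y\<in>lie_carrier L. \<forall>z\<in>lie_carrier L.
        lie_bracket L x (lie_bracket L y z) + lie_bracket L y (lie_bracket L z x)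
          + lie_bracket L z (lie_bracket L x y) = 0)"

text \<open>
  As everywhere in \<^theory>\<open>HOL.Vector_Spaces\<close>, the dimension is \<open>0\<close> by convention for an
  infinite-dimensional space; hence \<open>lie_dim L = n\<close> with \<open>n > 0\<close> implies finite dimension.
\<close>

definition lie_dim :: "('a::ab_group_add) lie_alg \<Rightarrow> nat" where
  "lie_dim L = vector_space.dim (lie_scale L) (lie_carrier L)"

definition lie_subalgebra :: "'a set \<Rightarrow> ('a::ab_group_add) lie_alg \<Rightarrow> bool" where
  "lie_subalgebra S L \<longleftrightarrow>
     S \<subseteq> lie_carrier L \<and> module.subspace (lie_scale L) S \<and>
     (\<forall>x\<in>S. \<forall>y\<in>S. lie_bracket L x y \<in> S)"

definition lie_center :: "('a::ab_group_add) lie_alg \<Rightarrow> 'a set" where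
  "lie_center L = {x \<in> lie_carrier L. \<forall>y\<in>lie_carrier L. lie_bracket L x y = 0}"

fun lie_lower_central :: "('a::ab_group_add) lie_alg \<Rightarrow> nat \<Rightarrow> 'a set" where
  "lie_lower_central L 0 = lie_carrier L"
| "lie_lower_central L (Suc k) =
     module.span (lie_scale L)
       {lie_bracket L x y | x y. x \<in> lie_carrier L \<and> y \<in> lie_lower_central L k}"

definition lie_nilpotent :: "('a::ab_group_add) lie_alg \<Rightarrow> bool" where
  "lie_nilpotent L \<longleftrightarrow> (\<exists>k. lie_lower_central L k = {0})"

text \<open>
  Linear maps on the carrier are represented by functions that vanish outside it, so that
  equality and linear (in)dependence of such functions mean what they should.
\<close>

definition lie_endomorphisms :: "('a::ab_group_add) lie_alg \<Rightarrow> ('a \<Rightarrow> 'a) set" where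
  "lie_endomorphisms L =
     {f. (\<forall>x\<in>lie_carrier L. f x \<in> lie_carrier L) \<and>
         (\<forall>x\<in>lie_carrier L. \<forall>y\<in>lie_carrier L. f (x + y) = f x + f y) \<and>
         (\<forall>c. \<forall>x\<in>lie_carrier L. f (lie_scale L c x) = lie_scale L c (f x)) \<and>
         (\<forall>x. x \<notin> lie_carrier L \<longrightarrow> f x = 0)}"

definition lie_derivations :: "('a::ab_group_add) lie_alg \<Rightarrow> ('a \<Rightarrow> 'a) set" where
  "lie_derivations L =
     {f \<in> lie_endomorphisms L. \<forall>x\<in>lie_carrier L. \<forall>y\<in>lie_carrier L.
        f (lie_bracket L x y) = lie_bracket L (f x) y + lie_bracket L x (f y)}"

definition lie_Der :: "('a::ab_group_add) lie_alg \<Rightarrow> ('a \<Rightarrow> 'a) lie_alg" where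
  "lie_Der L =
     \<lparr> lie_carrier = lie_derivations L,
       lie_scale = (\<lambda>c f x. lie_scale L c (f x)),
       lie_bracket = (\<lambda>f g x. f (g x) - g (f x)) \<rparr>"

definition lie_complete :: "('a::ab_group_add) lie_alg \<Rightarrow> bool" where
  "lie_complete L \<longleftrightarrow>
     lie_center L = {0} \<and>
     (\<forall>f\<in>lie_derivations L. \<exists>x\<in>lie_carrier L. \<forall>y\<in>lie_carrier L. f y = lie_bracket L x y)"

text \<open>Every invariant subspace has an invariant complement.\<close>

definition lie_semisimple :: "('a::ab_group_add) lie_alg \<Rightarrow> ('a \<Rightarrow> 'a) \<Rightarrow> bool" where
  "lie_semisimple L f \<longleftrightarrow>
     (\<forall>U. module.subspace (lie_scale L) U \<and> U \<subseteq> lie_carrier L \<and> f ` U \<subseteq> U \<longrightarrow>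
       (\<exists>W. module.subspace (lie_scale L) W \<and> W \<subseteq> lie_carrier L \<and> f ` W \<subseteq> W \<and>
            U \<inter> W = {0} \<and> lie_carrier L = {u + w | u w. u \<in> U \<and> w \<in> W}))"

definition lie_torus :: "('a::ab_group_add) lie_alg \<Rightarrow> ('a \<Rightarrow> 'a) set \<Rightarrow> bool" where
  "lie_torus L T \<longleftrightarrow>
     lie_subalgebra T (lie_Der L) \<and>
     (\<forall>f\<in>T. \<forall>g\<in>T. lie_bracket (lie_Der L) f g = 0) \<and>
     (\<forall>f\<in>T. lie_semisimple L f)"

definition lie_maximal_torus :: "('a::ab_group_add) lie_alg \<Rightarrow> ('a \<Rightarrow> 'a) set \<Rightarrow> bool" where
  "lie_maximal_torus L T \<longleftrightarrow>
     lie_torus L T \<and> (\<forall>T'. lie_torus L T' \<and> T \<subseteq> T' \<longrightarrow> T' = T)"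

text \<open>All maximal tori have the same dimension, so the choice does not matter.\<close>

definition lie_rank :: "('a::ab_group_add) lie_alg \<Rightarrow> nat" where
  "lie_rank L =
     vector_space.dim (lie_scale (lie_Der L)) (SOME T. lie_maximal_torus L T)"

text \<open>
  The first cohomology with trivial coefficients: the cocycles are the linear functionals vanishing
  on all brackets, i.e. the dual of \<open>L / [L, L]\<close>, and the only coboundary is \<open>0\<close>.
\<close>

definition lie_H1 :: "('a::ab_group_add) lie_alg \<Rightarrow> ('a \<Rightarrow> complex) set" where
  "lie_H1 L =
     {\<phi>. (\<forall>x\<in>lie_carrier L. \<forall>y\<in>lie_carrier L. \<phi> (x + y) = \<phi> x + \<phi> y) \<and>
         (\<forall>c. \<forall>x\<in>lie_carrier L. \<phi> (lie_scale L c x) = c * \<phi> x) \<and>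
         (\<forall>x\<in>lie_carrier L. \<forall>y\<in>lie_carrier L. \<phi> (lie_bracket L x y) = 0) \<and>
         (\<forall>x. x \<notin> lie_carrier L \<longrightarrow> \<phi> x = 0)}"

definition lie_maximal_rank :: "('a::ab_group_add) lie_alg \<Rightarrow> bool" where
  "lie_maximal_rank L \<longleftrightarrow>
     lie_rank L = vector_space.dim (\<lambda>c \<phi> x. c * \<phi> x) (lie_H1 L)"

text \<open>\<open>T\<close> is abelian, so the first component of the bracket is \<open>0\<close>.\<close>

definition lie_semidirect ::
    "('a \<Rightarrow> 'a) set \<Rightarrow> ('a::ab_group_add) lie_alg \<Rightarrow> (('a \<Rightarrow> 'a) \<times> 'a) lie_alg" where
  "lie_semidirect T L =
     \<lparr> lie_carrier = T \<times> lie_carrier L,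
       lie_scale = (\<lambda>c (f, x). (lie_scale (lie_Der L) c f, lie_scale L c x)),
       lie_bracket = (\<lambda>(f, x) (g, y). (0, f y - g x + lie_bracket L x y)) \<rparr>"

definition lie_completable :: "('a::ab_group_add) lie_alg \<Rightarrow> bool" where
  "lie_completable L \<longleftrightarrow>
     (\<exists>T. lie_maximal_torus L T \<and> lie_complete (lie_semidirect T L))"

end

theory Submission
  imports Defs
begin

text \<open>
  The witness is the filiform algebra \<open>m\<^sub>2(n)\<close> with basis \<open>e\<^sub>1, \<dots>, e\<^sub>n\<close> and nonzero brackets
  \<open>[e\<^sub>1, e\<^sub>i] = e\<^sub>i\<^sub>+\<^sub>1\<close> for \<open>2 \<le> i < n\<close> and \<open>[e\<^sub>2, e\<^sub>i] = e\<^sub>i\<^sub>+\<^sub>2\<close> for \<open>3 \<le> i \<le> n - 2\<close>.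
  It is generated by \<open>e\<^sub>1\<close> and \<open>e\<^sub>2\<close>, so \<open>H\<^sup>1\<close> has dimension 2. For \<open>n \<ge> 5\<close>, comparing the two
  expressions \<open>[e\<^sub>1, e\<^sub>4] = e\<^sub>5 = [e\<^sub>2, e\<^sub>3]\<close> shows that every derivation is triangular with diagonal
  \<open>(a, 2a, \<dots>, na)\<close>. If \<open>a = 0\<close> it is nilpotent, so a semisimple one vanishes; hence every torus has
  dimension at most 1, and the degree derivation \<open>d e\<^sub>i = i e\<^sub>i\<close> spans a maximal one.

  The degree derivation is invertible on \<open>m\<^sub>2(n)\<close>. Therefore the center of the semidirect product is
  zero, and a derivation of it can be corrected by an inner one so as to kill \<open>d\<close> up to a multiple
  of \<open>d\<close>. What remains has degree 0, hence is diagonal on \<open>m\<^sub>2(n)\<close>, hence a multiple of \<open>ad d\<close>.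
\<close>

section \<open>The algebra\<close>

text \<open>One ambient type serves every dimension, and indexing from 1 makes the position of a
  coordinate equal to its degree.\<close>

definition m2_carrier :: "nat \<Rightarrow> (nat \<Rightarrow> complex) set" where
  "m2_carrier n = {x. \<forall>i. i \<notin> {1..n} \<longrightarrow> x i = 0}"

definition scale_fun :: "complex \<Rightarrow> (nat \<Rightarrow> complex) \<Rightarrow> nat \<Rightarrow> complex" where
  "scale_fun c x = (\<lambda>i. c * x i)"

text \<open>The coefficient at \<open>k\<close> collects the contributions of
  \<open>[e_1, e_(k-1)]\<close> and \<open>[e_2, e_(k-2)]\<close>. The bound 5 in the second line
  leaves out \<open>[e_2, e_1]\<close>, already counted in the first line at
  \<open>k = 3\<close>.\<close>

definition m2_bracket :: "nat \<Rightarrow> (nat \<Rightarrow> complex) \<Rightarrow> (nat \<Rightarrow> complex) \<Rightarrow> nat \<Rightarrow> complex" where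
  "m2_bracket n x y = (\<lambda>k.
     (if 3 \<le> k \<and> k \<le> n then x 1 * y (k - 1) - y 1 * x (k - 1) else 0) +
     (if 5 \<le> k \<and> k \<le> n then x 2 * y (k - 2) - y 2 * x (k - 2) else 0))"

definition m2 :: "nat \<Rightarrow> (nat \<Rightarrow> complex) lie_alg" where
  "m2 n = \<lparr> lie_carrier = m2_carrier n, lie_scale = scale_fun, lie_bracket = m2_bracket n \<rparr>"

definition basis_vec :: "nat \<Rightarrow> nat \<Rightarrow> complex" where
  "basis_vec k = (\<lambda>i. if i = k then 1 else 0)"

text \<open>The filtration by degree. It carries both the nilpotency of the algebra and the
  triangular shape of its derivations.\<close>

definition m2_filt :: "nat \<Rightarrow> nat \<Rightarrow> (nat \<Rightarrow> complex) set" where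
  "m2_filt n k = {x \<in> m2_carrier n. \<forall>i<k. x i = 0}"

lemma m2_simps [simp]:
  "lie_carrier (m2 n) = m2_carrier n" "lie_scale (m2 n) = scale_fun"
  "lie_bracket (m2 n) = m2_bracket n"
  by (simp_all add: m2_def)

declare One_nat_def [simp del]

interpretation V: vector_space scale_fun
  by unfold_locales (auto simp: scale_fun_def fun_eq_iff algebra_simps)

lemma scale_fun_apply [simp]: "scale_fun c x i = c * x i"
  by (simp add: scale_fun_def)

lemma subspace_m2_carrier: "V.subspace (m2_carrier n)"
  by (auto simp: V.subspace_def m2_carrier_def)

lemma subspace_m2_filt: "V.subspace (m2_filt n k)"
  by (auto simp: V.subspace_def m2_carrier_def m2_filt_def)

lemmas m2_carrier_add [simp, intro] = V.subspace_add [OF subspace_m2_carrier]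
lemmas m2_carrier_diff [simp, intro] = V.subspace_diff [OF subspace_m2_carrier]
lemmas m2_carrier_scale [simp, intro] = V.subspace_scale [OF subspace_m2_carrier]
lemmas m2_carrier_zero [simp] = V.subspace_0 [OF subspace_m2_carrier]

lemma basis_vec_in_carrier [simp]: "basis_vec k \<in> m2_carrier n \<longleftrightarrow> 1 \<le> k \<and> k \<le> n"
  by (auto simp: basis_vec_def m2_carrier_def)

lemma basis_vec_apply: "basis_vec k i = (if i = k then 1 else 0)"
  by (simp add: basis_vec_def)

lemma basis_vec_same [simp]: "basis_vec k k = 1"
  and basis_vec_other [simp]: "i \<noteq> k \<Longrightarrow> basis_vec k i = 0"
  by (simp_all add: basis_vec_def)

lemma m2_bracket_apply: "m2_bracket n x y k =
     (if 3 \<le> k \<and> k \<le> n then x 1 * y (k - 1) - y 1 * x (k - 1) else 0) +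
     (if 5 \<le> k \<and> k \<le> n then x 2 * y (k - 2) - y 2 * x (k - 2) else 0)"
  by (simp add: m2_bracket_def)

lemma m2_bracket_in_carrier [simp]: "m2_bracket n x y \<in> m2_carrier n"
  by (auto simp: m2_bracket_def m2_carrier_def)

lemma m2_bracket_linear:
  "m2_bracket n (x + y) z = m2_bracket n x z + m2_bracket n y z"
  "m2_bracket n x (y + z) = m2_bracket n x y + m2_bracket n x z"
  "m2_bracket n (scale_fun c x) y = scale_fun c (m2_bracket n x y)"
  "m2_bracket n x (scale_fun c y) = scale_fun c (m2_bracket n x y)"
  "m2_bracket n 0 x = 0" "m2_bracket n x 0 = 0"
  by (auto simp: m2_bracket_def fun_eq_iff algebra_simps)

lemma m2_bracket_self: "m2_bracket n x x = 0"
  by (auto simp: m2_bracket_def fun_eq_iff)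

lemma m2_jacobi:
  "m2_bracket n x (m2_bracket n y z) + m2_bracket n y (m2_bracket n z x)
     + m2_bracket n z (m2_bracket n x y) = 0"
proof
  fix k :: nat
  \<comment> \<open>The nested indices \<open>k - 1\<close> and \<open>k - 2\<close> are compared
    with 3 and 5, so from degree 7 on every condition from below holds; the smaller degrees are
    checked one by one.\<close>
  have "k < 3 \<or> k = 3 \<or> k = 4 \<or> k = 5 \<or> k = 6 \<or> k = (k - 7) + 7" by arith
  then consider "k < 3" | "k = 3" | "k = 4" | "k = 5" | "k = 6" | j where "k = j + 7" by blast
  then show "(m2_bracket n x (m2_bracket n y z) + m2_bracket n y (m2_bracket n z x)
     + m2_bracket n z (m2_bracket n x y)) k = 0 k"
    by cases (auto simp: m2_bracket_def algebra_simps)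
qed

lemma lie_algebra_m2: "lie_algebra (m2 n)"
  unfolding lie_algebra_def m2_simps
  using V.vector_space_axioms subspace_m2_carrier
  by (intro conjI ballI allI) (simp_all add: m2_bracket_linear m2_jacobi m2_bracket_self)

section \<open>Dimension\<close>

lemma sum_basis_vec_apply:
  assumes "finite A"
  shows "(\<Sum>k\<in>A. scale_fun (c k) (basis_vec k)) i = (if i \<in> A then c i else 0)"
  using assms by (induction A) (auto simp: basis_vec_def)

lemma m2_dim: "lie_dim (m2 n) = n"
proof -
  have 1: "basis_vec ` {1..n} \<subseteq> m2_carrier n" by auto
  have inj: "inj_on basis_vec {1..n}"
    by (auto simp: inj_on_def basis_vec_def fun_eq_iff split: if_splits)
  have 2: "V.independent (basis_vec ` {1..n})"
  proof (rule V.independent_if_scalars_zero)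
    fix f v assume *: "(\<Sum>v\<in>basis_vec ` {1..n}. scale_fun (f v) v) = 0" "v \<in> basis_vec ` {1..n}"
    then obtain k where k: "k \<in> {1..n}" "v = basis_vec k" by auto
    have "(\<Sum>j\<in>{1..n}. scale_fun (f (basis_vec j)) (basis_vec j)) k = 0"
      using *(1) unfolding sum.reindex[OF inj] o_def by (metis zero_fun_apply)
    then show "f v = 0" using k by (subst (asm) sum_basis_vec_apply) auto
  qed auto
  have 3: "m2_carrier n \<subseteq> V.span (basis_vec ` {1..n})"
  proof
    fix x assume x: "x \<in> m2_carrier n"
    have "x = (\<Sum>k\<in>{1..n}. scale_fun (x k) (basis_vec k))"
      using x by (auto simp: fun_eq_iff sum_basis_vec_apply m2_carrier_def)
    then show "x \<in> V.span (basis_vec ` {1..n})"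
      by (metis (no_types, lifting) V.span_sum V.span_scale V.span_base imageI)
  qed
  show ?thesis
    unfolding lie_dim_def m2_simps using V.dim_unique[OF 1 3 2] inj by (simp add: card_image)
qed

section \<open>Nilpotency by the degree filtration\<close>

lemma m2_bracket_filt:
  assumes "x \<in> m2_carrier n" "y \<in> m2_filt n k"
  shows "m2_bracket n x y \<in> m2_filt n (Suc k)"
proof -
  have "m2_bracket n x y i = 0" if "i \<le> k" for i
    using assms that by (auto simp: m2_filt_def m2_bracket_def)
  then show ?thesis by (auto simp: m2_filt_def)
qed

lemma m2_filt_Suc_dim: "m2_filt n (Suc n) = {0}"
proof -
  have "x = 0" if "x \<in> m2_filt n (Suc n)" for x
  proof
    fix i show "x i = 0 i"
      using that by (cases "i \<le> n") (auto simp: m2_filt_def m2_carrier_def)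
  qed
  then show ?thesis using V.subspace_0[OF subspace_m2_filt] by auto
qed

text \<open>Every bracket raises the lowest degree by at least one. The shift to
  \<open>Suc k\<close> arises because the series starts at index 0 and the degrees at 1.\<close>

lemma m2_lower_central: "lie_lower_central (m2 n) k \<subseteq> m2_filt n (Suc k)"
proof (induction k)
  case 0
  show ?case by (auto simp: m2_filt_def m2_carrier_def)
next
  case (Suc k)
  show ?case
    unfolding lie_lower_central.simps m2_simps
    by (rule V.span_minimal[OF _ subspace_m2_filt]) (use Suc m2_bracket_filt in blast)
qed

lemma m2_nilpotent:
  assumes "0 < n"
  shows "lie_nilpotent (m2 n)"
proof -
  \<comment> \<open>As a successor index, the \<open>n\<close>-th term unfolds to a span and so
    contains 0.\<close>
  from assms obtain m where m: "n = Suc m" using gr0_implies_Suc by blast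
  have "lie_lower_central (m2 n) n \<subseteq> m2_filt n (Suc n)" by (rule m2_lower_central)
  moreover have "0 \<in> lie_lower_central (m2 n) n"
    by (simp add: m V.span_zero)
  ultimately show ?thesis unfolding lie_nilpotent_def m2_filt_Suc_dim by blast
qed

section \<open>Derivations\<close>

text \<open>Peeling off the term of lowest degree drives the downward inductions that
  follow.\<close>

lemma m2_filt_split:
  assumes "x \<in> m2_filt n k" "1 \<le> k" "k \<le> n"
  obtains z where "z \<in> m2_filt n (Suc k)" "x = scale_fun (x k) (basis_vec k) + z"
proof
  show "x - scale_fun (x k) (basis_vec k) \<in> m2_filt n (Suc k)"
    using assms by (auto simp: m2_filt_def m2_carrier_def basis_vec_def less_Suc_eq)
qed simp

lemma lie_endomorphisms_m2:
  assumes "f \<in> lie_endomorphisms (m2 n)"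
  shows "\<And>x. f x \<in> m2_carrier n"
    and "\<And>x y. x \<in> m2_carrier n \<Longrightarrow> y \<in> m2_carrier n \<Longrightarrow> f (x + y) = f x + f y"
    and "\<And>c x. x \<in> m2_carrier n \<Longrightarrow> f (scale_fun c x) = scale_fun c (f x)"
    and "\<And>x. x \<notin> m2_carrier n \<Longrightarrow> f x = 0"
    and "f 0 = 0"
proof -
  show "\<And>x. f x \<in> m2_carrier n"
    using assms m2_carrier_zero unfolding lie_endomorphisms_def m2_simps by (metis (mono_tags, lifting) mem_Collect_eq)
  show *: "\<And>x y. x \<in> m2_carrier n \<Longrightarrow> y \<in> m2_carrier n \<Longrightarrow> f (x + y) = f x + f y"
    and "\<And>c x. x \<in> m2_carrier n \<Longrightarrow> f (scale_fun c x) = scale_fun c (f x)"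
    and "\<And>x. x \<notin> m2_carrier n \<Longrightarrow> f x = 0"
    using assms by (auto simp: lie_endomorphisms_def)
  show "f 0 = 0" using *[of 0 0] by simp
qed

lemma lie_derivations_m2:
  assumes "f \<in> lie_derivations (m2 n)"
  shows "f \<in> lie_endomorphisms (m2 n)"
    and "\<And>x y. x \<in> m2_carrier n \<Longrightarrow> y \<in> m2_carrier n \<Longrightarrow>
           f (m2_bracket n x y) = m2_bracket n (f x) y + m2_bracket n x (f y)"
  using assms by (auto simp: lie_derivations_def)

text \<open>Passes from basis vectors to all vectors by descending induction on the lowest degree,
  starting at \<open>Suc n\<close>, where the filtration is zero.\<close>

lemma m2_endomorphism_triangular:
  assumes f: "f \<in> lie_endomorphisms (m2 n)"
    and tri: "\<And>k. 1 \<le> k \<Longrightarrow> k \<le> n \<Longrightarrow> f (basis_vec k) \<in> m2_filt n k"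
    and diag: "\<And>k. 1 \<le> k \<Longrightarrow> k \<le> n \<Longrightarrow> f (basis_vec k) k = c k"
    and k: "1 \<le> k" "k \<le> Suc n" and x: "x \<in> m2_filt n k"
  shows "f x \<in> m2_filt n k \<and> f x k = c k * x k"
  using k(2) k(1) x
proof (induction k arbitrary: x rule: inc_induct)
  case base
  then show ?case using lie_endomorphisms_m2(5)[OF f] V.subspace_0[OF subspace_m2_filt]
    unfolding m2_filt_Suc_dim by (metis mult_zero_right singletonD zero_fun_apply)
next
  case (step k)
  note lin = lie_endomorphisms_m2[OF f]
  obtain z where z: "z \<in> m2_filt n (Suc k)" "x = scale_fun (x k) (basis_vec k) + z"
    using step m2_filt_split by (metis less_Suc_eq_le)
  have kn: "k \<le> n" using step by simp
  have zc: "z \<in> m2_carrier n" using z by (simp add: m2_filt_def)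
  have "f x = f (scale_fun (x k) (basis_vec k) + z)" using z(2) by simp
  also have "\<dots> = scale_fun (x k) (f (basis_vec k)) + f z"
    using lin(2,3) zc step kn by simp
  finally have fx: "f x = scale_fun (x k) (f (basis_vec k)) + f z" .
  have fz: "f z \<in> m2_filt n (Suc k)" using step.IH[OF _ z(1)] by simp
  show ?case
  proof -
    have "f x i = 0" if "i < k" for i
      using fz tri[of k] kn step.prems that unfolding fx by (simp add: m2_filt_def)
    moreover have "f x k = c k * x k"
      using fz diag[of k] kn step.prems unfolding fx by (simp add: m2_filt_def)
    ultimately show ?thesis using lin(1)[of x] by (simp add: m2_filt_def)
  qed
qed

lemma m2_endomorphism_eqI:
  assumes f: "f \<in> lie_endomorphisms (m2 n)" and g: "g \<in> lie_endomorphisms (m2 n)"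
    and eq: "\<And>k. 1 \<le> k \<Longrightarrow> k \<le> n \<Longrightarrow> f (basis_vec k) = g (basis_vec k)"
  shows "f = g"
proof -
  note linf = lie_endomorphisms_m2[OF f] and ling = lie_endomorphisms_m2[OF g]
  have *: "f x = g x" if "1 \<le> k" "k \<le> Suc n" "x \<in> m2_filt n k" for x k
    using that(2,1,3)
  proof (induction k arbitrary: x rule: inc_induct)
    case base
    then show ?case using linf(5) ling(5) unfolding m2_filt_Suc_dim by (metis singletonD)
  next
    case (step k)
    have kn: "k \<le> n" using step by simp
    obtain z where z: "z \<in> m2_filt n (Suc k)" "x = scale_fun (x k) (basis_vec k) + z"
      using step kn m2_filt_split by metis
    have zc: "z \<in> m2_carrier n" using z by (simp add: m2_filt_def)
    have "f (scale_fun (x k) (basis_vec k) + z) = g (scale_fun (x k) (basis_vec k) + z)"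
      using linf(2,3) ling(2,3) zc kn step.prems step.IH[OF _ z(1)] eq by simp
    then show ?case using z(2) by simp
  qed
  show ?thesis
  proof
    fix x
    show "f x = g x"
    proof (cases "x \<in> m2_carrier n")
      case True
      then have "x \<in> m2_filt n 1" by (auto simp: m2_filt_def m2_carrier_def)
      then show ?thesis using *[of 1] by simp
    qed (simp add: linf ling)
  qed
qed

lemma m2_bracket_basis:
  assumes "2 \<le> k" "k < n"
  shows "m2_bracket n (basis_vec 1) (basis_vec k) = basis_vec (Suc k)"
  using assms by (auto simp: m2_bracket_def basis_vec_def fun_eq_iff)

lemma m2_bracket_basis_23:
  assumes "5 \<le> n"
  shows "m2_bracket n (basis_vec 2) (basis_vec 3) = basis_vec 5"
  using assms by (auto simp: m2_bracket_def basis_vec_def fun_eq_iff)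

text \<open>Write \<open>a\<close> and \<open>b\<close> for the diagonal entries at
  \<open>e_1\<close> and \<open>e_2\<close>. The relations \<open>[e_1, e_k] = e_(k+1)\<close> give
  the entry \<open>(k - 2) a + b\<close> for \<open>k \<ge> 3\<close>. The relation
  \<open>[e_2, e_3] = e_5\<close> then supplies the two missing facts: \<open>f e_2\<close> has no
  \<open>e_1\<close> component, and \<open>b = 2 a\<close>.\<close>

lemma m2_derivation_basis:
  assumes f: "f \<in> lie_derivations (m2 n)" and n: "5 \<le> n" and k: "1 \<le> k" "k \<le> n"
  shows "f (basis_vec k) \<in> m2_filt n k"
    and "f (basis_vec k) k = of_nat k * f (basis_vec 1) 1"
proof -
  note der = lie_derivations_m2(2)[OF f] and lin = lie_endomorphisms_m2[OF lie_derivations_m2(1)[OF f]]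
  have f0: "f x 0 = 0" for x using lin(1)[of x] by (auto simp: m2_carrier_def)
  have step: "f (basis_vec (Suc k)) =
      m2_bracket n (f (basis_vec 1)) (basis_vec k) + m2_bracket n (basis_vec 1) (f (basis_vec k))"
    if "2 \<le> k" "k < n" for k
    using der[of "basis_vec 1" "basis_vec k"] that by (simp add: m2_bracket_basis)
  \<comment> \<open>The induction starts at 3: an \<open>e_1\<close> component of
    \<open>f e_2\<close> is not yet excluded, but it disappears in
    \<open>[e_1, f e_2]\<close>.\<close>
  have filt3: "f (basis_vec k) \<in> m2_filt n k \<and>
      f (basis_vec k) k = (of_nat k - 2) * f (basis_vec 1) 1 + f (basis_vec 2) 2"
    if "3 \<le> k" "k \<le> n" for k
    using that
  proof (induction k rule: nat_induct_at_least)
    case base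
    have "f (basis_vec 3) j = 0" if "j < 3" for j
      using that step[of 2] n by (simp add: m2_bracket_apply)
    moreover have "f (basis_vec 3) 3 = f (basis_vec 1) 1 + f (basis_vec 2) 2"
      using step[of 2] n by (simp add: m2_bracket_apply basis_vec_apply)
    ultimately show ?case using lin(1) by (simp add: m2_filt_def)
  next
    case (Suc k)
    have ek: "basis_vec k \<in> m2_filt n k"
      using Suc by (auto simp: m2_filt_def basis_vec_apply)
    have "f (basis_vec (Suc k)) \<in> m2_filt n (Suc k)"
      using step[of k] Suc lin(1) ek
      by (simp add: m2_bracket_filt V.subspace_add[OF subspace_m2_filt])
    moreover have "f (basis_vec (Suc k)) (Suc k) = f (basis_vec 1) 1 + f (basis_vec k) k"
    proof -
      have "k - 1 \<noteq> k" "k - 1 \<noteq> 1" "f (basis_vec k) 2 = 0" "f (basis_vec k) 1 = 0"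
        using Suc by (auto simp: m2_filt_def)
      then show ?thesis using step[of k] Suc by (simp add: m2_bracket_apply)
    qed
    ultimately show ?case using Suc by (simp add: algebra_simps)
  qed
  have f5: "f (basis_vec 5) = m2_bracket n (f (basis_vec 2)) (basis_vec 3) +
      m2_bracket n (basis_vec 2) (f (basis_vec 3))"
    using der[of "basis_vec 2" "basis_vec 3"] n m2_bracket_basis_23[OF n] by simp
  have f3: "f (basis_vec 3) j = 0" if "j < 3" for j
    using filt3[of 3] n that by (simp add: m2_filt_def)
  \<comment> \<open>In degree 4 only \<open>[f e_2, e_3]\<close> contributes, since
    \<open>[e_2, f e_3]\<close> starts in degree 5.\<close>
  have "f (basis_vec 5) 4 = f (basis_vec 2) 1"
    using f5 n f3 by (simp add: m2_bracket_apply basis_vec_apply)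
  moreover have "f (basis_vec 5) 4 = 0"
    using filt3[of 5] n by (simp add: m2_filt_def)
  ultimately have f21: "f (basis_vec 2) 1 = 0" by simp
  \<comment> \<open>Degree 5 yields \<open>3 a + b = b + (a + b)\<close>.\<close>
  have "f (basis_vec 5) 5 = f (basis_vec 2) 2 + f (basis_vec 3) 3"
    using f5 n f3 by (simp add: m2_bracket_apply basis_vec_apply)
  then have f22: "f (basis_vec 2) 2 = 2 * f (basis_vec 1) 1"
    using filt3[of 5] filt3[of 3] n by (simp add: algebra_simps)
  consider "k = 1" | "k = 2" | "3 \<le> k" using k by linarith
  then have "f (basis_vec k) \<in> m2_filt n k \<and> f (basis_vec k) k = of_nat k * f (basis_vec 1) 1"
  proof cases
    case 1
    then show ?thesis using lin(1) f0 by (simp add: m2_filt_def)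
  next
    case 2
    then show ?thesis using lin(1) f0 f21 f22
      by (auto simp: m2_filt_def less_2_cases_iff simp flip: One_nat_def)
  next
    case 3
    then show ?thesis using filt3[OF 3 k(2)] f22 by (simp add: algebra_simps)
  qed
  then show "f (basis_vec k) \<in> m2_filt n k"
    and "f (basis_vec k) k = of_nat k * f (basis_vec 1) 1" by auto
qed

section \<open>Tori\<close>

definition m2_degree :: "nat \<Rightarrow> complex \<Rightarrow> (nat \<Rightarrow> complex) \<Rightarrow> nat \<Rightarrow> complex" where
  "m2_degree n c x = (if x \<in> m2_carrier n then (\<lambda>i. c * of_nat i * x i) else 0)"

definition m2_torus :: "nat \<Rightarrow> ((nat \<Rightarrow> complex) \<Rightarrow> nat \<Rightarrow> complex) set" where
  "m2_torus n = range (m2_degree n)"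

lemma m2_degree_apply: "x \<in> m2_carrier n \<Longrightarrow> m2_degree n c x i = c * of_nat i * x i"
  by (simp add: m2_degree_def)

lemma m2_degree_in_carrier [simp]: "m2_degree n c x \<in> m2_carrier n"
  by (auto simp: m2_degree_def m2_carrier_def)

lemma m2_degree_endomorphism: "m2_degree n c \<in> lie_endomorphisms (m2 n)"
  unfolding lie_endomorphisms_def m2_simps
  by (auto simp: m2_degree_apply fun_eq_iff algebra_simps) (simp add: m2_degree_def)

text \<open>The bracket is graded: degrees add, as
  \<open>1 + (k - 1) = 2 + (k - 2) = k\<close>.\<close>

lemma m2_degree_derivation: "m2_degree n c \<in> lie_derivations (m2 n)"
proof -
  have "m2_degree n c (m2_bracket n x y) =
      m2_bracket n (m2_degree n c x) y + m2_bracket n x (m2_degree n c y)"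
    if "x \<in> m2_carrier n" "y \<in> m2_carrier n" for x y
    using that
    by (auto simp: fun_eq_iff m2_degree_apply m2_bracket_apply of_nat_diff algebra_simps)
  then show ?thesis using m2_degree_endomorphism by (simp add: lie_derivations_def)
qed

definition scale_end :: "complex \<Rightarrow> ((nat \<Rightarrow> complex) \<Rightarrow> nat \<Rightarrow> complex) \<Rightarrow> (nat \<Rightarrow> complex) \<Rightarrow> nat \<Rightarrow> complex" where
  "scale_end c f = (\<lambda>x. scale_fun c (f x))"

interpretation E: vector_space scale_end
  by unfold_locales (auto simp: scale_end_def fun_eq_iff algebra_simps)

lemma lie_Der_m2_simps [simp]:
  "lie_carrier (lie_Der (m2 n)) = lie_derivations (m2 n)"
  "lie_scale (lie_Der (m2 n)) = scale_end"
  "lie_bracket (lie_Der (m2 n)) = (\<lambda>f g x. f (g x) - g (f x))"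
  by (auto simp: lie_Der_def scale_end_def fun_eq_iff)

lemma m2_degree_span: "m2_torus n = E.span {m2_degree n 1}"
proof -
  have "m2_degree n c = scale_end c (m2_degree n 1)" for c
    by (auto simp: fun_eq_iff scale_end_def m2_degree_def)
  then show ?thesis unfolding m2_torus_def E.span_singleton by metis
qed

text \<open>Applying \<open>d - j\<close>, with \<open>d\<close> the degree derivation, removes the component \<open>j\<close> of \<open>u\<close> and keeps
  the component \<open>i\<close> nonzero.\<close>

lemma m2_degree_invariant_basis:
  assumes U: "V.subspace U" "U \<subseteq> m2_carrier n" "m2_degree n 1 ` U \<subseteq> U"
    and u: "u \<in> U" "u i \<noteq> 0"
  shows "basis_vec i \<in> U"
  using u
proof (induction "card {j \<in> {1..n}. u j \<noteq> 0}" arbitrary: u rule: less_induct)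
  case less
  have uc: "u \<in> m2_carrier n" using less.prems U by blast
  show ?case
  proof (cases "\<exists>j. j \<noteq> i \<and> u j \<noteq> 0")
    case True
    then obtain j where j: "j \<noteq> i" "u j \<noteq> 0" by blast
    define v where "v = m2_degree n 1 u - scale_fun (of_nat j) u"
    have v: "v k = (of_nat k - of_nat j) * u k" for k
      using uc by (simp add: v_def m2_degree_apply algebra_simps)
    have "v \<in> U"
      unfolding v_def using U less.prems(1) by (intro V.subspace_diff V.subspace_scale) auto
    moreover have "v i \<noteq> 0" using j less.prems v by simp
    moreover have "{k \<in> {1..n}. v k \<noteq> 0} \<subset> {k \<in> {1..n}. u k \<noteq> 0}"
      using j(2) uc v unfolding m2_carrier_def psubset_eq by auto
    ultimately show ?thesis using less.hyps[of v] psubset_card_mono[of "{k \<in> {1..n}. u k \<noteq> 0}"] by simp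
  next
    case False
    then have "scale_fun (1 / u i) u = basis_vec i"
      using less.prems(2) by (auto simp: fun_eq_iff basis_vec_def)
    then show ?thesis using V.subspace_scale[OF U(1) less.prems(1)] by metis
  qed
qed

lemma subspace_complement:
  assumes U: "V.subspace U" "U \<subseteq> m2_carrier n"
  obtains W where "V.subspace W" "W \<subseteq> m2_carrier n" "U \<inter> W = {0}"
    "m2_carrier n = {u + w | u w. u \<in> U \<and> w \<in> W}"
proof -
  interpret VV: vector_space_pair scale_fun scale_fun ..
  obtain p where p: "range p \<subseteq> U" "Vector_Spaces.linear scale_fun scale_fun p" "\<And>u. u \<in> U \<Longrightarrow> p u = u"
    using VV.linear_exists_left_inverse_on[OF V.linear_ident U(1)] by auto
  interpret p: Vector_Spaces.linear scale_fun scale_fun p by fact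
  let ?W = "{x \<in> m2_carrier n. p x = 0}"
  have sub: "V.subspace ?W"
    using subspace_m2_carrier[of n] by (auto simp: V.subspace_def p.add p.scale)
  have "\<exists>u w. x = u + w \<and> u \<in> U \<and> w \<in> ?W" if "x \<in> m2_carrier n" for x
  proof -
    have "x = p x + (x - p x)" by simp
    moreover have "p x \<in> U" using p(1) by auto
    moreover from this have "x - p x \<in> ?W" using that U(2) by (auto simp: p.diff p(3))
    ultimately show ?thesis by metis
  qed
  then have "m2_carrier n = {u + w | u w. u \<in> U \<and> w \<in> ?W}" using U(2) by auto
  moreover have "U \<inter> ?W = {0}" using p(3) V.subspace_0[OF U(1)] by auto
  ultimately show ?thesis using that[OF sub] by blast
qed

lemma m2_degree_semisimple: "lie_semisimple (m2 n) (m2_degree n c)"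
  unfolding lie_semisimple_def m2_simps
proof (intro allI impI, elim conjE)
  fix U assume U: "V.subspace U" "U \<subseteq> m2_carrier n" "m2_degree n c ` U \<subseteq> U"
  show "\<exists>W. V.subspace W \<and> W \<subseteq> m2_carrier n \<and> m2_degree n c ` W \<subseteq> W \<and>
            U \<inter> W = {0} \<and> m2_carrier n = {u + w | u w. u \<in> U \<and> w \<in> W}"
  proof (cases "c = 0")
    case True
    obtain W where W: "V.subspace W" "W \<subseteq> m2_carrier n" "U \<inter> W = {0}"
      "m2_carrier n = {u + w | u w. u \<in> U \<and> w \<in> W}"
      using subspace_complement[OF U(1,2)] .
    have "m2_degree n c x = 0" for x
      by (auto simp: True m2_degree_def fun_eq_iff)
    then have "m2_degree n c ` W \<subseteq> W" using V.subspace_0[OF W(1)] by auto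
    then show ?thesis using W by blast
  next
    case False
    \<comment> \<open>For \<open>c \<noteq> 0\<close>, invariance can be rescaled to the degree
      derivation itself.\<close>
    have U1: "m2_degree n 1 ` U \<subseteq> U"
    proof
      fix v assume "v \<in> m2_degree n 1 ` U"
      then obtain u where u: "u \<in> U" "v = m2_degree n 1 u" by auto
      have "v = scale_fun (1 / c) (m2_degree n c u)"
        using False u U(2) by (auto simp: fun_eq_iff m2_degree_def)
      then show "v \<in> U" using u U V.subspace_scale[OF U(1)] by blast
    qed
    \<comment> \<open>An invariant \<open>U\<close> contains \<open>e_i\<close> as soon as some
      member has a nonzero component \<open>i\<close>. Hence \<open>U\<close> is spanned by basis
      vectors, and the remaining ones span a complement.\<close>
    let ?W = "{x \<in> m2_carrier n. \<forall>i. basis_vec i \<in> U \<longrightarrow> x i = 0}"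
    have "V.subspace ?W"
      using subspace_m2_carrier[of n] by (auto simp: V.subspace_def)
    moreover have "m2_degree n c ` ?W \<subseteq> ?W" by (auto simp: m2_degree_apply)
    moreover have "U \<inter> ?W = {0}"
      using m2_degree_invariant_basis[OF U(1,2) U1] V.subspace_0[OF U(1)]
      by (fastforce simp: fun_eq_iff)
    moreover have "\<exists>u w. x = u + w \<and> u \<in> U \<and> w \<in> ?W" if x: "x \<in> m2_carrier n" for x
    proof -
      define u where "u = (\<Sum>k\<in>{k \<in> {1..n}. basis_vec k \<in> U}. scale_fun (x k) (basis_vec k))"
      have u: "u i = (if i \<in> {1..n} \<and> basis_vec i \<in> U then x i else 0)" for i
        by (simp add: u_def sum_basis_vec_apply)
      have uU: "u \<in> U"
        unfolding u_def using U(1) by (intro V.subspace_sum V.subspace_scale) auto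
      have "x - u \<in> m2_carrier n" using x uU U(2) by auto
      moreover have "(x - u) i = 0" if "basis_vec i \<in> U" for i
        using that x by (auto simp: u m2_carrier_def)
      ultimately have "x - u \<in> ?W" by blast
      moreover have "x = u + (x - u)" by simp
      ultimately show ?thesis using uU by blast
    qed
    then have "m2_carrier n = {u + w | u w. u \<in> U \<and> w \<in> ?W}" using U(2) by auto
    ultimately show ?thesis by (intro exI[of _ ?W]) auto
  qed
qed

text \<open>With zero diagonal, \<open>f\<close> strictly raises degree. If \<open>W\<close> is an
  invariant complement of the image, then \<open>f\<close> maps \<open>W\<close> into
  \<open>W\<close> and into the image, hence to 0. So the image equals its own image under
  \<open>f\<close>, and iterating pushes it beyond degree \<open>n\<close>.\<close>

lemma m2_semisimple_derivation_zero:
  assumes f: "f \<in> lie_derivations (m2 n)" and n: "5 \<le> n"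
    and ss: "lie_semisimple (m2 n) f" and f1: "f (basis_vec 1) 1 = 0"
  shows "f = 0"
proof -
  note fe = lie_derivations_m2(1)[OF f]
  note lin = lie_endomorphisms_m2[OF fe]
  have raise: "f x \<in> m2_filt n (Suc k)" if "x \<in> m2_filt n k" "1 \<le> k" "k \<le> n" for x k
    using m2_endomorphism_triangular[OF fe, of "\<lambda>_. 0" k x] m2_derivation_basis[OF f n] f1 that
    by (auto simp: m2_filt_def less_Suc_eq)
  let ?U = "f ` m2_carrier n"
  have "V.subspace ?U"
    unfolding V.subspace_def
  proof (intro conjI ballI allI)
    show "0 \<in> ?U" using lin(5) m2_carrier_zero by force
    show "x + y \<in> ?U" if "x \<in> ?U" "y \<in> ?U" for x y
      using that lin(2) by (auto simp flip: lin(2))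
    show "scale_fun c x \<in> ?U" if "x \<in> ?U" for c x
      using that by (auto simp flip: lin(3))
  qed
  moreover have "?U \<subseteq> m2_carrier n" "f ` ?U \<subseteq> ?U" using lin(1) by auto
  ultimately obtain W where W: "W \<subseteq> m2_carrier n" "f ` W \<subseteq> W" "?U \<inter> W = {0}"
      "m2_carrier n = {u + w | u w. u \<in> ?U \<and> w \<in> W}"
    using ss unfolding lie_semisimple_def m2_simps by meson
  have W0: "f w = 0" if "w \<in> W" for w
    using that W(1-3) by blast
  have "?U \<subseteq> m2_filt n k" if "1 \<le> k" "k \<le> Suc n" for k
    using that
  proof (induction k rule: nat_induct_at_least)
    case base
    show ?case using lin(1) by (auto simp: m2_filt_def m2_carrier_def)
  next
    case (Suc k)
    have "f x \<in> m2_filt n (Suc k)" if "x \<in> m2_carrier n" for x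
    proof -
      obtain u w where uw: "x = u + w" "u \<in> ?U" "w \<in> W" using W(4) \<open>x \<in> m2_carrier n\<close> by blast
      then have "f x = f u" using lin(1) lin(2)[of u w] W(1) W0[of w] by auto
      moreover have "u \<in> m2_filt n k" using Suc uw(2) by auto
      ultimately show ?thesis using raise Suc by auto
    qed
    then show ?case by blast
  qed
  from this[of "Suc n"] have "f x = 0" if "x \<in> m2_carrier n" for x
    using that unfolding m2_filt_Suc_dim by auto
  then show ?thesis using lin(4) by (metis ext zero_fun_apply)
qed

section \<open>Maximality of the degree torus and the bound on the rank\<close>

lemma m2_degree_basis_1: "1 \<le> n \<Longrightarrow> m2_degree n c (basis_vec 1) 1 = c"
  by (simp add: m2_degree_apply basis_vec_apply)

lemma m2_torus_torus: "lie_torus (m2 n) (m2_torus n)"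
proof -
  have comm: "m2_degree n a (m2_degree n b x) = m2_degree n b (m2_degree n a x)" for a b x
  proof (cases "x \<in> m2_carrier n")
    case True
    then show ?thesis by (auto simp: fun_eq_iff m2_degree_apply)
  next
    case False
    then show ?thesis by (auto simp: fun_eq_iff m2_degree_def)
  qed
  have sub: "E.subspace (m2_torus n)"
    unfolding m2_degree_span by simp
  have 0: "(\<lambda>x. 0) \<in> m2_torus n"
    using E.subspace_0[OF sub] by (simp add: zero_fun_def)
  show ?thesis
    unfolding lie_torus_def lie_subalgebra_def lie_Der_m2_simps
    using sub m2_degree_derivation m2_degree_semisimple comm 0
    by (auto simp: m2_torus_def fun_eq_iff)
qed

text \<open>Reading off the diagonal entry at \<open>e_1\<close> is linear and, by semisimplicity of
  the difference, injective on a torus. This gives both the maximality of \<open>m2_torus\<close>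
  and the dimension bound.\<close>

lemma m2_torus_elem_eq:
  assumes T: "lie_torus (m2 n) T" and n: "5 \<le> n" and fg: "f \<in> T" "g \<in> T"
    and eq: "f (basis_vec 1) 1 = g (basis_vec 1) 1"
  shows "f = g"
proof -
  have "f - g \<in> T"
    using T fg E.subspace_diff unfolding lie_torus_def lie_subalgebra_def lie_Der_m2_simps by blast
  then have "f - g \<in> lie_derivations (m2 n)" "lie_semisimple (m2 n) (f - g)"
    using T unfolding lie_torus_def lie_subalgebra_def lie_Der_m2_simps by blast+
  moreover have "(f - g) (basis_vec 1) 1 = 0" using eq by (simp add: fun_diff_def)
  ultimately have "f - g = 0" using m2_semisimple_derivation_zero n by blast
  then show ?thesis by simp
qed

lemma m2_torus_maximal:
  assumes n: "5 \<le> n"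
  shows "lie_maximal_torus (m2 n) (m2_torus n)"
  unfolding lie_maximal_torus_def
proof (intro conjI allI impI m2_torus_torus, elim conjE)
  fix T assume T: "lie_torus (m2 n) T" "m2_torus n \<subseteq> T"
  have "f \<in> m2_torus n" if "f \<in> T" for f
  proof -
    let ?g = "m2_degree n (f (basis_vec 1) 1)"
    have g: "?g \<in> m2_torus n" by (simp add: m2_torus_def)
    then have "f = ?g"
      using m2_torus_elem_eq[OF T(1) n that, of ?g] T(2) m2_degree_basis_1[of n] n by auto
    then show ?thesis using g by simp
  qed
  then show "T = m2_torus n" using T(2) by blast
qed

text \<open>Stated for an arbitrary torus because \<open>lie_rank\<close> measures an unspecified
  maximal one; no conjugacy of maximal tori has to be invoked.\<close>

lemma m2_torus_dim_le:
  assumes T: "lie_torus (m2 n) T" and n: "5 \<le> n"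
  shows "E.dim T \<le> 1"
proof -
  have sub: "E.subspace T"
    using T unfolding lie_torus_def lie_subalgebra_def lie_Der_m2_simps by blast
  have "\<exists>g. T \<subseteq> E.span {g}"
  proof (cases "\<exists>g\<in>T. g (basis_vec 1) 1 \<noteq> 0")
    case True
    then obtain g where g: "g \<in> T" "g (basis_vec 1) 1 \<noteq> 0" by blast
    have "f \<in> E.span {g}" if "f \<in> T" for f
    proof -
      let ?c = "f (basis_vec 1) 1 / g (basis_vec 1) 1"
      have "f = scale_end ?c g"
        using m2_torus_elem_eq[OF T n that] E.subspace_scale[OF sub g(1)] g(2)
        by (metis nonzero_eq_divide_eq scale_end_def scale_fun_apply)
      then show ?thesis unfolding E.span_singleton by blast
    qed
    then show ?thesis by blast
  next
    case False
    then have "f = 0" if "f \<in> T" for f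
      using m2_torus_elem_eq[OF T n that E.subspace_0[OF sub]] that by simp
    then have "T \<subseteq> E.span {0}" using E.span_zero by blast
    then show ?thesis by blast
  qed
  then obtain g where "T \<subseteq> E.span {g}" by blast
  from E.dim_le_card[OF this] show ?thesis by simp
qed

section \<open>Cohomology and rank\<close>

text \<open>Everything of degree at least 3 is a bracket with \<open>e_1\<close>: the preimage is
  \<open>x\<close> shifted down by one degree.\<close>

lemma m2_filt_3_bracket:
  assumes "x \<in> m2_filt n 3"
  obtains y where "y \<in> m2_carrier n" "m2_bracket n (basis_vec 1) y = x"
proof
  let ?y = "\<lambda>i. if 2 \<le> i \<and> i < n then x (i + 1) else 0"
  show "?y \<in> m2_carrier n" by (auto simp: m2_carrier_def)
  show "m2_bracket n (basis_vec 1) ?y = x"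
  proof
    fix k
    show "m2_bracket n (basis_vec 1) ?y k = x k"
      using assms by (cases "3 \<le> k \<and> k \<le> n")
        (auto simp: m2_bracket_apply basis_vec_apply m2_filt_def m2_carrier_def)
  qed
qed

lemma m2_H1_dim:
  assumes n: "2 \<le> n"
  shows "vector_space.dim (\<lambda>c \<phi> x. c * \<phi> x) (lie_H1 (m2 n)) = 2"
proof -
  interpret F: vector_space "\<lambda>c (\<phi> :: (nat \<Rightarrow> complex) \<Rightarrow> complex) x. c * \<phi> x"
    by unfold_locales (auto simp: fun_eq_iff algebra_simps)
  \<comment> \<open>The coordinates 1 and 2 vanish on brackets, which start in degree 3; they will
    form a basis of the cohomology.\<close>
  define p where "p k x = (if x \<in> m2_carrier n then x k else 0)" for k :: nat and x :: "nat \<Rightarrow> complex"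
  have p: "p j (basis_vec k) = (if j = k then 1 else 0)" if "1 \<le> k" "k \<le> 2" for j k
    using that n by (simp add: p_def basis_vec_apply)
  have mem: "p k \<in> lie_H1 (m2 n)" if "k \<le> 2" for k
    using that by (auto simp: lie_H1_def p_def m2_bracket_apply)
  have "\<phi> \<in> F.span {p 1, p 2}" if "\<phi> \<in> lie_H1 (m2 n)" for \<phi>
  proof -
    have add: "\<And>x y. x \<in> m2_carrier n \<Longrightarrow> y \<in> m2_carrier n \<Longrightarrow> \<phi> (x + y) = \<phi> x + \<phi> y"
      and scale: "\<And>c x. x \<in> m2_carrier n \<Longrightarrow> \<phi> (scale_fun c x) = c * \<phi> x"
      and br: "\<And>x y. x \<in> m2_carrier n \<Longrightarrow> y \<in> m2_carrier n \<Longrightarrow> \<phi> (m2_bracket n x y) = 0"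
      and out: "\<And>x. x \<notin> m2_carrier n \<Longrightarrow> \<phi> x = 0"
      using that by (auto simp: lie_H1_def)
    have "\<phi> x = \<phi> (basis_vec 1) * p 1 x + \<phi> (basis_vec 2) * p 2 x" for x
    proof (cases "x \<in> m2_carrier n")
      case True
      \<comment> \<open>Splitting twice leaves \<open>x = x_1 e_1 + x_2 e_2 + z\<close> with
        \<open>z\<close> of degree at least 3, a bracket on which \<open>\<phi>\<close>
        vanishes.\<close>
      have "x \<in> m2_filt n 1" using True by (auto simp: m2_filt_def m2_carrier_def)
      then obtain y where y: "y \<in> m2_filt n (Suc 1)" "x = scale_fun (x 1) (basis_vec 1) + y"
        using m2_filt_split n by (metis le_trans one_le_numeral order_refl)
      moreover have "Suc 1 = 2" by simp
      ultimately obtain z where z: "z \<in> m2_filt n (Suc 2)" "y = scale_fun (y 2) (basis_vec 2) + z"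
        using m2_filt_split[of y n 2] n by (metis one_le_numeral)
      have "y 2 = x 2"
        using fun_cong[OF y(2), of 2] by (simp add: basis_vec_apply)
      moreover have "\<phi> z = 0"
      proof -
        have "z \<in> m2_filt n 3" using z(1) by (simp add: numeral_3_eq_3 numeral_2_eq_2)
        then obtain v where "v \<in> m2_carrier n" "m2_bracket n (basis_vec 1) v = z"
          by (rule m2_filt_3_bracket)
        then show ?thesis using br[of "basis_vec 1" v] n by simp
      qed
      moreover have "\<phi> x = x 1 * \<phi> (basis_vec 1) + \<phi> y"
        using arg_cong[OF y(2), of \<phi>] y(1) n add[of "scale_fun (x 1) (basis_vec 1)" y]
          scale[of "basis_vec 1" "x 1"] by (auto simp: m2_filt_def)
      moreover have "\<phi> y = y 2 * \<phi> (basis_vec 2) + \<phi> z"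
        using arg_cong[OF z(2), of \<phi>] z(1) n add[of "scale_fun (y 2) (basis_vec 2)" z]
          scale[of "basis_vec 2" "y 2"] by (auto simp: m2_filt_def)
      ultimately show ?thesis using True by (simp add: p_def)
    qed (simp add: out p_def)
    then have "\<phi> = (\<lambda>x. \<phi> (basis_vec 1) * p 1 x) + (\<lambda>x. \<phi> (basis_vec 2) * p 2 x)"
      unfolding plus_fun_def by (rule ext)
    also have "\<dots> \<in> F.span {p 1, p 2}"
      by (intro F.span_add F.span_scale F.span_base) auto
    finally show ?thesis .
  qed
  moreover have "p 1 \<noteq> p 2" using p[of 1 1] p[of 1 2] by auto
  moreover have "F.independent {p 1, p 2}"
  proof -
    have "p 2 \<noteq> 0" using p[of 2 2] by auto
    moreover have "p 1 \<notin> F.span {p 2}"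
    proof
      assume "p 1 \<in> F.span {p 2}"
      then obtain c where "p 1 = (\<lambda>x. c * p 2 x)" unfolding F.span_singleton by blast
      then show False using p[of 1 1] p[of 1 2] by auto
    qed
    ultimately show ?thesis using \<open>p 1 \<noteq> p 2\<close> by (simp add: F.independent_insert)
  qed
  ultimately show ?thesis
    using mem[of 1] mem[of 2] by (intro F.dim_unique[of "{p 1, p 2}"]) auto
qed

lemma m2_not_maximal_rank:
  assumes n: "5 \<le> n"
  shows "\<not> lie_maximal_rank (m2 n)"
proof -
  have "lie_maximal_torus (m2 n) (SOME T. lie_maximal_torus (m2 n) T)"
    using m2_torus_maximal[OF n] by (rule someI)
  then have "lie_rank (m2 n) \<le> 1"
    unfolding lie_rank_def lie_Der_m2_simps lie_maximal_torus_def
    using m2_torus_dim_le n by blast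
  then show ?thesis unfolding lie_maximal_rank_def using m2_H1_dim[of n] n by simp
qed

section \<open>Completability\<close>

text \<open>The Jacobi identity, rearranged by antisymmetry into the Leibniz rule.\<close>

lemma m2_inner_derivation:
  assumes y: "y \<in> m2_carrier n"
  shows "(\<lambda>x. if x \<in> m2_carrier n then m2_bracket n y x else 0) \<in> lie_derivations (m2 n)"
proof -
  have "m2_bracket n y (m2_bracket n a b) = m2_bracket n (m2_bracket n y a) b + m2_bracket n a (m2_bracket n y b)" for a b
  proof -
    have anti: "m2_bracket n u v = - m2_bracket n v u" for u v
      by (auto simp: fun_eq_iff m2_bracket_apply)
    have neg: "m2_bracket n u (- v) = - m2_bracket n u v" for u v
      by (auto simp: fun_eq_iff m2_bracket_apply)
    show ?thesis
      using m2_jacobi[of n y a b] anti[of b "m2_bracket n y a"] anti[of b y] neg[of a "m2_bracket n y b"]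
      by (simp add: algebra_simps eq_neg_iff_add_eq_0)
  qed
  then show ?thesis
    by (auto simp: lie_derivations_def lie_endomorphisms_def m2_bracket_linear)
qed

lemma m2_derivation_diff:
  assumes f: "f \<in> lie_derivations (m2 n)" and g: "g \<in> lie_derivations (m2 n)"
  shows "f - g \<in> lie_derivations (m2 n)"
proof -
  note f' = lie_derivations_m2(2)[OF f] lie_endomorphisms_m2[OF lie_derivations_m2(1)[OF f]]
  note g' = lie_derivations_m2(2)[OF g] lie_endomorphisms_m2[OF lie_derivations_m2(1)[OF g]]
  have br: "m2_bracket n (a - b) c = m2_bracket n a c - m2_bracket n b c"
    "m2_bracket n c (a - b) = m2_bracket n c a - m2_bracket n c b" for a b c
    by (auto simp: fun_eq_iff m2_bracket_apply algebra_simps)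
  show ?thesis
    unfolding lie_derivations_def lie_endomorphisms_def m2_simps
    using f' g' by (auto simp: br V.scale_right_diff_distrib)
qed

text \<open>The hypothesis \<open>gr\<close> says that the commutator of \<open>f\<close> with the
  degree derivation \<open>d\<close> is \<open>c d\<close>. Its entry at \<open>(1, 1)\<close> gives
  \<open>c = 0\<close>. Then \<open>k\<close> times the entry at \<open>(k, j)\<close> equals
  \<open>j\<close> times it, so \<open>f\<close> is diagonal and its diagonal is known.\<close>

lemma m2_derivation_graded:
  assumes f: "f \<in> lie_derivations (m2 n)" and n: "5 \<le> n"
    and gr: "\<And>x. x \<in> m2_carrier n \<Longrightarrow> f (m2_degree n 1 x) = m2_degree n c x + m2_degree n 1 (f x)"
  shows "c = 0" and "f = m2_degree n (f (basis_vec 1) 1)"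
proof -
  note lin = lie_endomorphisms_m2[OF lie_derivations_m2(1)[OF f]]
  have e: "of_nat k * f (basis_vec k) j = c * of_nat j * basis_vec k j + of_nat j * f (basis_vec k) j"
    if k: "1 \<le> k" "k \<le> n" for k j
  proof -
    have "m2_degree n 1 (basis_vec k) = scale_fun (of_nat k) (basis_vec k)"
      using k by (auto simp: fun_eq_iff m2_degree_apply basis_vec_apply)
    then have "scale_fun (of_nat k) (f (basis_vec k)) = m2_degree n c (basis_vec k) + m2_degree n 1 (f (basis_vec k))"
      using gr[of "basis_vec k"] lin(3)[of "basis_vec k"] k by simp
    from fun_cong[OF this, of j] show ?thesis
      using k lin(1) by (simp add: m2_degree_apply)
  qed
  from e[of 1 1] n show c: "c = 0" by (simp add: basis_vec_apply)
  show "f = m2_degree n (f (basis_vec 1) 1)"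
  proof (rule m2_endomorphism_eqI[OF lie_derivations_m2(1)[OF f] m2_degree_endomorphism])
    fix k assume k: "1 \<le> k" "k \<le> n"
    have "f (basis_vec k) j = m2_degree n (f (basis_vec 1) 1) (basis_vec k) j" for j
      using e[OF k, of j] c m2_derivation_basis(2)[OF f n k] k
      by (cases "j = k") (auto simp: m2_degree_apply basis_vec_apply)
    then show "f (basis_vec k) = m2_degree n (f (basis_vec 1) 1) (basis_vec k)" by blast
  qed
qed

section \<open>The semidirect product with the degree torus\<close>

lemma m2_semidirect_simps [simp]:
  "lie_carrier (lie_semidirect T (m2 n)) = T \<times> m2_carrier n"
  "lie_bracket (lie_semidirect T (m2 n)) (f, x) (g, y) = (0, f y - g x + m2_bracket n x y)"
  "lie_scale (lie_semidirect T (m2 n)) c (f, x) = (scale_end c f, scale_fun c x)"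
  by (simp_all add: lie_semidirect_def)

lemma m2_degree_zero [simp]: "m2_degree n 0 = 0"
  by (auto simp: m2_degree_def fun_eq_iff)

lemma m2_degree_at_zero [simp]: "m2_degree n c 0 = 0"
  by (auto simp: m2_degree_def fun_eq_iff)

lemma m2_degree_1_surj:
  assumes x: "x \<in> m2_carrier n"
  obtains y where "y \<in> m2_carrier n" "m2_degree n 1 y = x"
proof
  \<comment> \<open>At index 0 the quotient is 0, in agreement with \<open>x 0 = 0\<close>.\<close>
  show "(\<lambda>i. x i / of_nat i) \<in> m2_carrier n" using x by (auto simp: m2_carrier_def)
  then show "m2_degree n 1 (\<lambda>i. x i / of_nat i) = x"
    using x by (auto simp: fun_eq_iff m2_degree_apply m2_carrier_def)
qed

text \<open>Bracketing a central \<open>(c d, x)\<close> with \<open>(d, 0)\<close> gives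
  \<open>d x = 0\<close>, hence \<open>x = 0\<close>; bracketing with \<open>(0, e_1)\<close> then
  gives \<open>c = 0\<close>.\<close>

lemma m2_semidirect_center:
  assumes n: "1 \<le> n"
  shows "lie_center (lie_semidirect (m2_torus n) (m2 n)) = {0}"
proof -
  have 0: "0 \<in> m2_torus n" using m2_degree_zero unfolding m2_torus_def by (metis rangeI)
  have *: "c = 0 \<and> x = 0"
    if x: "x \<in> m2_carrier n"
      and c: "\<forall>g\<in>m2_torus n. \<forall>y\<in>m2_carrier n. m2_degree n c y - g x + m2_bracket n x y = 0" for c x
  proof -
    have "m2_degree n 1 x = 0"
      using c[rule_format, of "m2_degree n 1" 0] by (simp add: m2_torus_def m2_bracket_linear)
    then have "x i = 0" for i
      using x m2_degree_apply[OF x, of 1 i] by (cases "i = 0") (auto simp: m2_carrier_def)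
    then have x0: "x = 0" by (auto simp: fun_eq_iff)
    then have "m2_degree n c (basis_vec 1) = 0"
      using c[rule_format, of 0 "basis_vec 1"] 0 n by (simp add: m2_bracket_linear)
    then show ?thesis using m2_degree_basis_1[OF n, of c] x0 by simp
  qed
  have "z = 0" if z0: "z \<in> lie_center (lie_semidirect (m2_torus n) (m2 n))" for z
  proof -
    obtain c x where z: "z = (m2_degree n c, x)" "x \<in> m2_carrier n"
      using z0 unfolding lie_center_def m2_semidirect_simps(1) m2_torus_def by blast
    have "m2_degree n c y - g x + m2_bracket n x y = 0"
      if "g \<in> m2_torus n" "y \<in> m2_carrier n" for g y
    proof -
      have "lie_bracket (lie_semidirect (m2_torus n) (m2 n)) z (g, y) = 0"
        using z0 that unfolding lie_center_def m2_semidirect_simps(1) by blast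
      then show ?thesis unfolding z(1) m2_semidirect_simps(2) zero_prod_def by blast
    qed
    then have "c = 0 \<and> x = 0" using * z(2) by blast
    then show ?thesis using z(1) by (simp add: zero_prod_def)
  qed
  moreover have "0 \<in> lie_center (lie_semidirect (m2_torus n) (m2 n))"
    using 0 by (auto simp: lie_center_def m2_torus_def zero_prod_def m2_bracket_linear)
  ultimately show ?thesis by blast
qed

lemma m2_semidirect_derivation_inner:
  assumes n: "5 \<le> n" and F: "F \<in> lie_derivations (lie_semidirect (m2_torus n) (m2 n))"
  shows "\<exists>z\<in>m2_torus n \<times> m2_carrier n. \<forall>w\<in>m2_torus n \<times> m2_carrier n.
           F w = lie_bracket (lie_semidirect (m2_torus n) (m2 n)) z w"
proof -
  let ?S = "lie_semidirect (m2_torus n) (m2 n)"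
  let ?D = "m2_degree n"
  have Dt: "?D c \<in> m2_torus n" for c by (simp add: m2_torus_def)
  then have 0: "0 \<in> m2_torus n" using m2_degree_zero by metis
  have carr: "F w \<in> m2_torus n \<times> m2_carrier n" if "w \<in> m2_torus n \<times> m2_carrier n" for w
    using F that unfolding lie_derivations_def lie_endomorphisms_def m2_semidirect_simps(1) by blast
  have add: "F (v + w) = F v + F w"
    if "v \<in> m2_torus n \<times> m2_carrier n" "w \<in> m2_torus n \<times> m2_carrier n" for v w
    using F that unfolding lie_derivations_def lie_endomorphisms_def m2_semidirect_simps(1) by blast
  have scale: "F (lie_scale ?S c v) = lie_scale ?S c (F v)" if "v \<in> m2_torus n \<times> m2_carrier n" for c v
    using F that unfolding lie_derivations_def lie_endomorphisms_def m2_semidirect_simps(1) by blast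
  have der: "F (lie_bracket ?S v w) = lie_bracket ?S (F v) w + lie_bracket ?S v (F w)"
    if "v \<in> m2_torus n \<times> m2_carrier n" "w \<in> m2_torus n \<times> m2_carrier n" for v w
    using F that unfolding lie_derivations_def m2_semidirect_simps(1) by blast
  obtain c u where u: "F (?D 1, 0) = (?D c, u)" "u \<in> m2_carrier n"
    using carr[of "(?D 1, 0)"] Dt by (auto simp: m2_torus_def)
  define B where "B x = (if x \<in> m2_carrier n then snd (F (0, x)) else 0)" for x
  have Bc: "B x \<in> m2_carrier n" for x
    using carr[of "(0, x)"] 0 by (auto simp: B_def mem_Times_iff)
  \<comment> \<open>Apply \<open>F\<close> to \<open>[d, x] = d x\<close>. The torus component of
    \<open>F (0, x)\<close> drops out because it commutes with \<open>d\<close>.\<close>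
  have D1: "F (0, ?D 1 x) = (0, ?D c x + ?D 1 (B x) + m2_bracket n u x)"
    if x: "x \<in> m2_carrier n" for x
  proof -
    obtain a where a: "F (0, x) = (?D a, B x)"
      using carr[of "(0, x)"] 0 x by (auto simp: m2_torus_def B_def)
    show ?thesis
      using der[of "(?D 1, 0)" "(0, x)"] x 0 Dt u a by (simp add: m2_bracket_linear)
  qed
  \<comment> \<open>Surjectivity of \<open>d\<close> shows that \<open>F\<close> preserves the
    nilpotent part, so \<open>B\<close> is its restriction.\<close>
  have FB: "F (0, x) = (0, B x)" if x: "x \<in> m2_carrier n" for x
  proof -
    obtain y where "y \<in> m2_carrier n" "?D 1 y = x" using m2_degree_1_surj[OF x] .
    then have "fst (F (0, x)) = 0" using D1[of y] by simp
    then show ?thesis using x by (simp add: B_def prod_eq_iff)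
  qed
  have Badd: "B (x + y) = B x + B y" if "x \<in> m2_carrier n" "y \<in> m2_carrier n" for x y
    using add[of "(0, x)" "(0, y)"] that 0 by (simp add: FB)
  have Bscale: "B (scale_fun a x) = scale_fun a (B x)" if "x \<in> m2_carrier n" for a x
    using scale[of "(0, x)" a] that 0 by (simp add: FB)
  have "B (m2_bracket n x y) = m2_bracket n (B x) y + m2_bracket n x (B y)"
    if "x \<in> m2_carrier n" "y \<in> m2_carrier n" for x y
    using der[of "(0, x)" "(0, y)"] that 0 by (simp add: FB)
  moreover have "B x = 0" if "x \<notin> m2_carrier n" for x using that by (simp add: B_def)
  ultimately have Bder: "B \<in> lie_derivations (m2 n)"
    using Bc Badd Bscale by (simp add: lie_derivations_def lie_endomorphisms_def)
  obtain v where v: "v \<in> m2_carrier n" "?D 1 v = u" using m2_degree_1_surj[OF u(2)] .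
  \<comment> \<open>Since \<open>d v = u\<close>, bracketing with \<open>v\<close> sends
    \<open>d\<close> to \<open>- u\<close>. Thus \<open>F + ad v\<close> maps \<open>d\<close> to
    \<open>c d\<close>, and \<open>G\<close> is its restriction to the nilpotent part.\<close>
  define G where "G = B - (\<lambda>x. if x \<in> m2_carrier n then m2_bracket n (- v) x else 0)"
  have v': "- v \<in> m2_carrier n" using v(1) V.subspace_neg[OF subspace_m2_carrier] by blast
  have G: "G \<in> lie_derivations (m2 n)"
    unfolding G_def using Bder m2_inner_derivation[OF v'] by (rule m2_derivation_diff)
  have G_eq: "G x = B x + m2_bracket n v x" if "x \<in> m2_carrier n" for x
    using that by (auto simp: G_def fun_eq_iff fun_diff_def m2_bracket_apply)
  have D_add: "?D a (x + y) = ?D a x + ?D a y" if "x \<in> m2_carrier n" "y \<in> m2_carrier n" for a x y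
    using lie_endomorphisms_m2(2)[OF m2_degree_endomorphism] that .
  have gr: "G (?D 1 x) = ?D c x + ?D 1 (G x)" if x: "x \<in> m2_carrier n" for x
  proof -
    have "B (?D 1 x) = ?D c x + ?D 1 (B x) + m2_bracket n u x"
      using D1[OF x] FB[of "?D 1 x"] by simp
    moreover have "?D 1 (m2_bracket n v x) = m2_bracket n u x + m2_bracket n v (?D 1 x)"
      using lie_derivations_m2(2)[OF m2_degree_derivation v(1) x] v(2) by simp
    ultimately show ?thesis
      using x Bc by (simp add: G_eq D_add add_ac)
  qed
  have c: "c = 0" using m2_derivation_graded(1)[OF G n gr] .
  define a where "a = G (basis_vec 1) 1"
  have Ga: "G = ?D a" unfolding a_def using m2_derivation_graded(2)[OF G n gr] .
  have Bx: "B x = ?D a x + m2_bracket n (- v) x" if "x \<in> m2_carrier n" for x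
    using that fun_cong[OF Ga, of x] by (simp add: G_def diff_eq_eq)
  \<comment> \<open>With \<open>c = 0\<close> and \<open>G = a d\<close>, undoing the correction
    leaves \<open>F = ad (a d - v)\<close>.\<close>
  have "F (?D b, x) = lie_bracket ?S (?D a, - v) (?D b, x)" if x: "x \<in> m2_carrier n" for b x
  proof -
    have eq: "(?D b, x) = lie_scale ?S b (?D 1, 0) + (0, x)"
      by (auto simp: scale_end_def fun_eq_iff m2_degree_def)
    have "F (?D b, x) = F (lie_scale ?S b (?D 1, 0)) + F (0, x)"
      unfolding eq
    proof (rule add)
      show "lie_scale ?S b (?D 1, 0) \<in> m2_torus n \<times> m2_carrier n"
        using eq Dt[of b] x by simp
    qed (use 0 x in simp)
    also have "F (lie_scale ?S b (?D 1, 0)) = lie_scale ?S b (?D c, u)"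
      using scale[of "(?D 1, 0)" b] Dt u by simp
    also have "\<dots> + F (0, x) = (0, scale_fun b u + B x)"
      using c FB[OF x] by (simp add: E.scale_zero_right)
    also have "scale_fun b u = - ?D b (- v)"
      using v v' by (auto simp: fun_eq_iff m2_degree_apply)
    finally have "F (?D b, x) = (0, - ?D b (- v) + B x)" .
    moreover have "- p + (q + r) = q - p + r" for p q r :: "nat \<Rightarrow> complex"
      by (simp add: algebra_simps)
    ultimately show ?thesis by (simp only: Bx[OF x] m2_semidirect_simps(2))
  qed
  then show ?thesis
    using Dt v' by (intro bexI[of _ "(?D a, - v)"]) (auto simp: m2_torus_def)
qed

lemma m2_completable:
  assumes n: "5 \<le> n"
  shows "lie_completable (m2 n)"
  unfolding lie_completable_def lie_complete_def
  using m2_torus_maximal[OF n] m2_semidirect_center[of n] m2_semidirect_derivation_inner[OF n] n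
  by (intro exI[of _ "m2_torus n"]) auto

theorem mainTheorem4:
  fixes n :: nat
  assumes "odd n" and "n \<ge> 9"
  shows "\<exists>L :: (nat \<Rightarrow> complex) lie_alg.
           lie_algebra L \<and> lie_dim L = n \<and> lie_nilpotent L \<and>
           lie_completable L \<and> \<not> lie_maximal_rank L"
  using assms lie_algebra_m2 m2_dim m2_nilpotent m2_completable m2_not_maximal_rank
  by (intro exI[of _ "m2 n"]) auto

end
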